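(* Let $k$ be a field of characteristic zero and let $A$ be the algebra of formal power series over $k$ in the noncommutative variables $X,Y$. For every integer $n>2$, the following identity holds in $A$: $$\bigl(2^n-(-1)^n-3\bigr)\langle X,Y\rangle_n=\pi_n\bigl\langle\langle X,Y\rangle,Y\bigr\rangle_{<n}-\pi_n\bigl\langle\langle Y,X\rangle,Y\bigr\rangle_{<n}+\pi_n\bigl\langle X,\langle\langle X,Y\rangle,Y\rangle\bigr\rangle_{<n}-\pi_n\bigl\langle X,\langle\langle Y,X\rangle,Y\rangle\bigr\rangle_{<n}.$$
   Context: $k$ is a field of characteristic zero; $A$ is the associative $k$-algebra of formal power series in two noncommutative variables $X,Y$; $A^{X,Y}\subset A$ is the ideal generated by $X,Y$ (the series with zero constant term). For $f\in A$ and $a,b\in A^{X,Y}$, the composite $f(a,b)$ (substitute $a$ for $X$ and $b$ for $Y$) is well defined. $\langle X,Y\rangle=\log(e^Xe^Y)\in A^{X,Y}$, and $\langle X,Y\rangle_m$ denotes its homogeneous term of degree $m$, so $\langle X,Y\rangle=\sum_{m\ge1}\langle X,Y\rangle_m$ and $\langle X,Y\rangle_1=X+Y$. For $a,b\in A^{X,Y}$, $\langle a,b\rangle=\log(e^ae^b)\in A^{X,Y}$ and $\langle a,b\rangle_m$ are the composites of $\langle X,Y\rangle$ and $\langle X,Y\rangle_m$ with $a,b$ (so $\langle a,b\rangle_m$ need not be homogeneous of degree $m$ in $X,Y$). For $a\in A^{X,Y}$ and $n\ge1$, $\pi_n a$ denotes the homogeneous term of $a$ of degree $n$ in $X,Y$.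 For $n>2$, $\langle a,b\rangle_{<n}=\sum_{1<m<n}\langle a,b\rangle_m$. *)

theory Defs
  imports Complex_Main "HOL-Library.Groups_Big_Fun"
begin

datatype letter = LX | LY

text \<open>A formal power series in two noncommutative variables is the family of its
  coefficients, indexed by all words in the two letters.\<close>

typedef 'k ncps = "UNIV :: (letter list \<Rightarrow> 'k) set"
  morphisms coeff Abs_ncps ..

setup_lifting type_definition_ncps

lemma ncps_eq_iff: "f = g \<longleftrightarrow> (\<forall>w. coeff f w = coeff g w)"
  by (auto simp: coeff_inject[symmetric] fun_eq_iff)

lemma ncps_eqI: "(\<And>w. coeff f w = coeff g w) \<Longrightarrow> f = g"
  by (simp add: ncps_eq_iff)

lemma coeff_Abs_ncps [simp]: "coeff (Abs_ncps h) = h"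
  by (simp add: Abs_ncps_inverse)

instantiation ncps :: (ring_1) ring_1
begin

lift_definition zero_ncps :: "'a ncps" is "\<lambda>_. 0" .
lift_definition one_ncps :: "'a ncps" is "\<lambda>w. if w = [] then 1 else 0" .
lift_definition plus_ncps :: "'a ncps \<Rightarrow> 'a ncps \<Rightarrow> 'a ncps" is "\<lambda>f g w. f w + g w" .
lift_definition uminus_ncps :: "'a ncps \<Rightarrow> 'a ncps" is "\<lambda>f w. - f w" .
lift_definition minus_ncps :: "'a ncps \<Rightarrow> 'a ncps \<Rightarrow> 'a ncps" is "\<lambda>f g w. f w - g w" .

lift_definition times_ncps :: "'a ncps \<Rightarrow> 'a ncps \<Rightarrow> 'a ncps" is
  "\<lambda>f g w. \<Sum>i\<le>length w. f (take i w) * g (drop i w)" .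

instance
proof
  fix a b c :: "'a ncps"
  show "a * b * c = a * (b * c)"
  proof transfer
    fix f g h :: "letter list \<Rightarrow> 'a"
    show "(\<lambda>w. \<Sum>i\<le>length w. (\<Sum>j\<le>length (take i w). f (take j (take i w)) * g (drop j (take i w))) * h (drop i w)) =
          (\<lambda>w. \<Sum>i\<le>length w. f (take i w) * (\<Sum>j\<le>length (drop i w). g (take j (drop i w)) * h (drop j (drop i w))))"
    proof
      fix w :: "letter list"
      let ?n = "length w"
      have "(\<Sum>i\<le>?n. (\<Sum>j\<le>length (take i w). f (take j (take i w)) * g (drop j (take i w))) * h (drop i w)) =
            (\<Sum>i\<le>?n. \<Sum>j\<le>i. f (take j w) * g (drop j (take i w)) * h (drop i w))"
        by (intro sum.cong refl) (auto simp: sum_distrib_right min_def intro!: sum.cong)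
      also have "\<dots> = (\<Sum>(i, j)\<in>(SIGMA i:{..?n}. {..i}). f (take j w) * g (drop j (take i w)) * h (drop i w))"
        by (subst sum.Sigma) auto
      also have "\<dots> = (\<Sum>(i, j)\<in>(SIGMA i:{..?n}. {..?n - i}). f (take i w) * g (take j (drop i w)) * h (drop (i + j) w))"
        by (rule sum.reindex_bij_witness[where i = "\<lambda>(i, j). (i + j, i)" and j = "\<lambda>(i, j). (j, i - j)"])
           (auto simp: drop_take)
      also have "\<dots> = (\<Sum>i\<le>?n. \<Sum>j\<le>?n - i. f (take i w) * g (take j (drop i w)) * h (drop (i + j) w))"
        by (subst sum.Sigma) auto
      also have "\<dots> = (\<Sum>i\<le>?n. f (take i w) * (\<Sum>j\<le>length (drop i w). g (take j (drop i w)) * h (drop j (drop i w))))"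
        by (intro sum.cong refl) (auto simp: sum_distrib_left mult.assoc add.commute intro!: sum.cong)
      finally show "(\<Sum>i\<le>?n. (\<Sum>j\<le>length (take i w). f (take j (take i w)) * g (drop j (take i w))) * h (drop i w)) =
            (\<Sum>i\<le>?n. f (take i w) * (\<Sum>j\<le>length (drop i w). g (take j (drop i w)) * h (drop j (drop i w))))" .
    qed
  qed
  show "1 * a = a"
  proof transfer
    fix f :: "letter list \<Rightarrow> 'a"
    have "(\<Sum>i\<le>length w. (if take i w = [] then 1 else 0) * f (drop i w)) = f w" for w
    proof -
      have "(\<Sum>i\<le>length w. (if take i w = [] then 1 else 0) * f (drop i w)) =
            (\<Sum>i\<in>{0}. (if take i w = [] then 1 else 0) * f (drop i w))"
        by (rule sum.mono_neutral_right) auto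
      then show ?thesis by simp
    qed
    then show "(\<lambda>w. \<Sum>i\<le>length w. (if take i w = [] then 1 else 0) * f (drop i w)) = f"
      by auto
  qed
  show "a * 1 = a"
  proof transfer
    fix f :: "letter list \<Rightarrow> 'a"
    have "(\<Sum>i\<le>length w. f (take i w) * (if drop i w = [] then 1 else 0)) = f w" for w
    proof -
      have "(\<Sum>i\<le>length w. f (take i w) * (if drop i w = [] then 1 else 0)) =
            (\<Sum>i\<in>{length w}. f (take i w) * (if drop i w = [] then 1 else 0))"
        by (rule sum.mono_neutral_right) auto
      then show ?thesis by simp
    qed
    then show "(\<lambda>w. \<Sum>i\<le>length w. f (take i w) * (if drop i w = [] then 1 else 0)) = f"
      by auto
  qed
  show "(a + b) * c = a * c + b * c"
    by transfer (simp add: distrib_right sum.distrib)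
  show "a * (b + c) = a * b + a * c"
    by transfer (simp add: distrib_left sum.distrib)
  show "(0 :: 'a ncps) \<noteq> 1"
    by transfer (auto dest: fun_cong[where x = "[]"])
qed (transfer; simp add: algebra_simps; fail)+

end

lift_definition ncX :: "'k::ring_1 ncps" is "\<lambda>w. if w = [LX] then 1 else 0" .
lift_definition ncY :: "'k::ring_1 ncps" is "\<lambda>w. if w = [LY] then 1 else 0" .

lift_definition nc_scale :: "'k::ring_1 \<Rightarrow> 'k ncps \<Rightarrow> 'k ncps" is "\<lambda>c f w. c * f w" .

definition hom_part :: "nat \<Rightarrow> 'k::ring_1 ncps \<Rightarrow> 'k ncps" where
  "hom_part n f = Abs_ncps (\<lambda>w. if length w = n then coeff f w else 0)"

text \<open>The infinite sums below are taken coefficientwise. They are meant for arguments with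
  zero constant term (constant term one for the logarithm), where every coefficient receives
  only finitely many nonzero contributions; see the finiteness lemmas further down.\<close>

definition nc_exp :: "'k::field_char_0 ncps \<Rightarrow> 'k ncps" where
  "nc_exp a = Abs_ncps (\<lambda>w. Sum_any (\<lambda>n. coeff (a ^ n) w / fact n))"

definition nc_log :: "'k::field_char_0 ncps \<Rightarrow> 'k ncps" where
  "nc_log f = Abs_ncps (\<lambda>w. Sum_any (\<lambda>n. (-1) ^ n / of_nat (Suc n) * coeff ((f - 1) ^ Suc n) w))"

fun word_subst :: "'k::ring_1 ncps \<Rightarrow> 'k ncps \<Rightarrow> letter list \<Rightarrow> 'k ncps" where
  "word_subst a b [] = 1"
| "word_subst a b (LX # u) = a * word_subst a b u"
| "word_subst a b (LY # u) = b * word_subst a b u"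

definition nc_compose :: "'k::ring_1 ncps \<Rightarrow> 'k ncps \<Rightarrow> 'k ncps \<Rightarrow> 'k ncps" where
  "nc_compose f a b = Abs_ncps (\<lambda>w. Sum_any (\<lambda>u. coeff f u * coeff (word_subst a b u) w))"

definition bch :: "'k::field_char_0 ncps \<Rightarrow> 'k ncps \<Rightarrow> 'k ncps" where
  "bch a b = nc_log (nc_exp a * nc_exp b)"

text \<open>The homogeneous part is taken before substituting, so \<open>bch_term m a b\<close> need not be
  homogeneous of degree \<open>m\<close>.\<close>

definition bch_term :: "nat \<Rightarrow> 'k::field_char_0 ncps \<Rightarrow> 'k ncps \<Rightarrow> 'k ncps" where
  "bch_term m a b = nc_compose (hom_part m (bch ncX ncY)) a b"

definition bch_lt :: "nat \<Rightarrow> 'k::field_char_0 ncps \<Rightarrow> 'k ncps \<Rightarrow> 'k ncps" where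
  "bch_lt n a b = (\<Sum>m\<in>{1<..<n}. bch_term m a b)"

lemma coeff_times: "coeff (f * g) w = (\<Sum>i\<le>length w. coeff f (take i w) * coeff g (drop i w))"
  by transfer simp

lemma coeff_times_low:
  assumes a: "coeff a [] = 0" and g: "\<And>v. length v < n \<Longrightarrow> coeff g v = 0"
    and w: "length w < Suc n"
  shows "coeff (a * g) w = 0"
proof -
  have "coeff a (take i w) * coeff g (drop i w) = 0" if "i \<le> length w" for i
  proof (cases "i = 0")
    case False
    then have "length (drop i w) < n" using w that by auto
    then show ?thesis using g by simp
  qed (simp add: a)
  then show ?thesis by (simp add: coeff_times)
qed

lemma coeff_power_low: "coeff a [] = 0 \<Longrightarrow> length w < n \<Longrightarrow> coeff (a ^ n) w = 0"
  by (induction n arbitrary: w) (auto intro: coeff_times_low)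

lemma coeff_word_subst_low:
  "coeff a [] = 0 \<Longrightarrow> coeff b [] = 0 \<Longrightarrow> length w < length u \<Longrightarrow> coeff (word_subst a b u) w = 0"
  by (induction a b u arbitrary: w rule: word_subst.induct) (auto intro: coeff_times_low)

lemma finite_nc_exp_terms:
  fixes a :: "'k::field_char_0 ncps"
  assumes "coeff a [] = 0"
  shows "finite {n. coeff (a ^ n) w / fact n \<noteq> 0}"
  by (rule finite_subset[of _ "{..length w}"])
     (use coeff_power_low[OF assms] not_le_imp_less in auto)

lemma finite_nc_log_terms:
  fixes f :: "'k::field_char_0 ncps"
  assumes "coeff f [] = 1"
  shows "finite {n. (-1) ^ n / of_nat (Suc n) * coeff ((f - 1) ^ Suc n) w \<noteq> 0}"
proof (rule finite_subset)
  have "coeff (f - 1) [] = 0"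
    using assms by transfer simp
  from coeff_power_low[OF this]
  have "coeff ((f - 1) ^ Suc n) w = 0" if "length w < Suc n" for n
    using that by blast
  then show "{n. (-1) ^ n / of_nat (Suc n) * coeff ((f - 1) ^ Suc n) w \<noteq> 0} \<subseteq> {..length w}"
    by (metis (mono_tags, lifting) atMost_iff less_SucI mem_Collect_eq mult_zero_right not_le_imp_less subsetI)
qed simp

lemma finite_nc_compose_terms:
  assumes "coeff a [] = 0" and "coeff b [] = 0"
  shows "finite {u. coeff f u * coeff (word_subst a b u) w \<noteq> 0}"
proof (rule finite_subset)
  have "x \<in> {LX, LY}" for x by (cases x) auto
  then have "finite (UNIV :: letter set)"
    by (metis finite.simps finite_subset subsetI)
  then show "finite {u :: letter list. set u \<subseteq> UNIV \<and> length u \<le> length w}"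
    by (rule finite_lists_length_le)
  show "{u. coeff f u * coeff (word_subst a b u) w \<noteq> 0} \<subseteq> {u. set u \<subseteq> UNIV \<and> length u \<le> length w}"
    using coeff_word_subst_low[OF assms] not_le_imp_less by fastforce
qed

lemma coeff_nc_exp_Nil:
  assumes "coeff a [] = 0"
  shows "coeff (nc_exp a) [] = 1"
proof -
  have "coeff (a ^ n) [] / fact n = (if n = 0 then 1 else 0)" for n
    using coeff_power_low[OF assms, of "[]" n] by (auto simp: one_ncps.rep_eq)
  then show ?thesis
    unfolding nc_exp_def coeff_Abs_ncps by (simp only: Sum_any.delta)
qed

lemma coeff_nc_log_Nil:
  assumes "coeff f [] = 1"
  shows "coeff (nc_log f) [] = 0"
proof -
  have "coeff (f - 1) [] = 0"
    using assms by transfer simp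
  then have "coeff ((f - 1) ^ Suc n) [] = 0" for n
    by (intro coeff_power_low) auto
  then show ?thesis
    unfolding nc_log_def coeff_Abs_ncps by (simp only: mult_zero_right Sum_any.neutral)
qed

lemma coeff_bch_Nil: "coeff a [] = 0 \<Longrightarrow> coeff b [] = 0 \<Longrightarrow> coeff (bch a b) [] = 0"
  unfolding bch_def by (rule coeff_nc_log_Nil) (simp add: coeff_times coeff_nc_exp_Nil)

end

theory Submission
  imports Defs "HOL-Computational_Algebra.Formal_Power_Series"
begin

text \<open>
  With \<open>H = \<langle>X,Y\<rangle>\<close>, compare \<open>\<langle>X,\<langle>\<langle>X,Y\<rangle>,Y\<rangle>\<rangle> = \<langle>2X,2Y\<rangle>\<close> with
  \<open>\<langle>X,\<langle>\<langle>Y,X\<rangle>,Y\<rangle>\<rangle> = log (e\<^sup>X e\<^sup>Y e\<^sup>X e\<^sup>Y) = 2H\<close>: their components of degree \<open>n\<close> differ by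
  \<open>(2\<^sup>n - 2) \<langle>X,Y\<rangle>\<^sub>n\<close>. On the other hand, \<open>\<pi>\<^sub>n\<langle>a,b\<rangle>\<close> is the sum of \<open>\<pi>\<^sub>n a + \<pi>\<^sub>n b\<close>,
  \<open>\<pi>\<^sub>n\<langle>a,b\<rangle>\<^bsub><n\<^esub>\<close> and \<open>\<langle>\<pi>\<^sub>1 a, \<pi>\<^sub>1 b\<rangle>\<^sub>n\<close>. Expanding the nested brackets this way, the last
  terms cancel because \<open>\<langle>X,Y\<rangle>\<close> and \<open>\<langle>Y,X\<rangle>\<close> have the same linear part, and what is left besides
  the four terms of the claim is \<open>\<langle>X,Y\<rangle>\<^sub>n - \<langle>Y,X\<rangle>\<^sub>n\<close>. Finally
  \<open>\<langle>Y,X\<rangle> = - \<langle>-X,-Y\<rangle>\<close> gives \<open>\<langle>Y,X\<rangle>\<^sub>n = - (-1)\<^sup>n \<langle>X,Y\<rangle>\<^sub>n\<close>.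
\<close>

section \<open>Coefficients of the basic operations\<close>

lemma coeff_ncps_simps [simp]:
  "coeff 0 w = 0"
  "coeff 1 w = (if w = [] then 1 else 0)"
  "coeff (f + g) w = coeff f w + coeff g w"
  "coeff (f - g) w = coeff f w - coeff g w"
  "coeff (- f) w = - coeff f w"
  "coeff (nc_scale c f) w = c * coeff f w"
  "coeff (hom_part n f) w = (if length w = n then coeff f w else 0)"
  "coeff ncX w = (if w = [LX] then 1 else 0)"
  "coeff ncY w = (if w = [LY] then 1 else 0)"
  by (simp_all add: zero_ncps.rep_eq one_ncps.rep_eq plus_ncps.rep_eq minus_ncps.rep_eq
      uminus_ncps.rep_eq nc_scale.rep_eq hom_part_def ncX.rep_eq ncY.rep_eq)

lemma coeff_sum [simp]: "coeff (\<Sum>i\<in>A. f i) w = (\<Sum>i\<in>A. coeff (f i) w)"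
  by (induction A rule: infinite_finite_induct) simp_all

lemma coeff_power_scale: "coeff (nc_scale c a ^ n) w = c ^ n * coeff (a ^ n) w"
  for a :: "'k::comm_ring_1 ncps"
proof (induction n arbitrary: w)
  case (Suc n)
  then show ?case by (simp add: coeff_times sum_distrib_left mult_ac)
qed simp

section \<open>Evaluation of univariate power series\<close>

text \<open>Substitution of \<open>a\<close> for the variable of a univariate series. If
  \<open>a\<close> has zero constant term, \<open>a ^ i\<close> vanishes on words shorter than
  \<open>i\<close>, so stopping at \<open>length w\<close> loses nothing. Identities for exp and log
  are thereby imported from commutative power series.\<close>

definition fps_eval :: "'k::comm_ring_1 ncps \<Rightarrow> 'k fps \<Rightarrow> 'k ncps" where
  "fps_eval a F = Abs_ncps (\<lambda>w. \<Sum>i\<le>length w. fps_nth F i * coeff (a ^ i) w)"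

text \<open>A bound \<open>N\<close> independent of the word gives all factors
  \<open>take l w\<close> and \<open>drop l w\<close> of \<open>w\<close> one common summation
  range.\<close>

lemma coeff_fps_eval:
  assumes "coeff a [] = 0" "length w \<le> N"
  shows "coeff (fps_eval a F) w = (\<Sum>i\<le>N. fps_nth F i * coeff (a ^ i) w)"
  unfolding fps_eval_def coeff_Abs_ncps
  by (rule sum.mono_neutral_left) (use assms coeff_power_low[OF assms(1)] in auto)

lemma coeff_fps_eval_Nil [simp]: "coeff (fps_eval a F) [] = fps_nth F 0"
  by (simp add: fps_eval_def)

lemma coeff_fps_eval_singleton: "coeff (fps_eval a F) [x] = fps_nth F 1 * coeff a [x]"
  by (simp add: fps_eval_def)

lemma fps_eval_1 [simp]: "fps_eval a 1 = 1"
  by (rule ncps_eqI) (simp add: fps_eval_def mult_delta_left)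

lemma fps_eval_X: "coeff a [] = 0 \<Longrightarrow> fps_eval a fps_X = a"
proof (rule ncps_eqI)
  fix w assume a: "coeff a [] = 0"
  have "coeff (fps_eval a fps_X) w = (\<Sum>i\<le>Suc (length w). fps_nth fps_X i * coeff (a ^ i) w)"
    by (rule coeff_fps_eval[OF a]) simp
  also have "\<dots> = (\<Sum>i\<in>{1}. fps_nth fps_X i * coeff (a ^ i) w)"
    by (rule sum.mono_neutral_right) auto
  finally show "coeff (fps_eval a fps_X) w = coeff a w" by simp
qed

lemma fps_eval_diff: "fps_eval a (F - G) = fps_eval a F - fps_eval a G"
  by (rule ncps_eqI) (simp add: fps_eval_def left_diff_distrib sum_subtractf)

lemma fps_eval_mult:
  assumes a: "coeff a [] = 0"
  shows "fps_eval a (F * G) = fps_eval a F * fps_eval a G"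
proof (rule ncps_eqI)
  fix w :: "letter list"
  let ?N = "length w"
  let ?t = "\<lambda>(i, j). fps_nth F i * fps_nth G j * coeff (a ^ (i + j)) w"
  have "coeff (fps_eval a (F * G)) w
      = (\<Sum>k\<le>?N. \<Sum>i\<le>k. fps_nth F i * fps_nth G (k - i) * coeff (a ^ (i + (k - i))) w)"
    by (simp add: fps_eval_def fps_mult_nth atMost_atLeast0 sum_distrib_right)
  also have "\<dots> = (\<Sum>p\<in>{(i, j). i + j \<le> ?N}. ?t p)"
    by (rule sum.triangle_reindex_eq[symmetric])
  \<comment> \<open>The triangle grows to a square: pairs with \<open>i + j > ?N\<close> contribute
    zero because \<open>w\<close> is too short for \<open>a ^ (i + j)\<close>.\<close>
  also have "\<dots> = (\<Sum>p\<in>{..?N} \<times> {..?N}. ?t p)"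
    by (rule sum.mono_neutral_left, auto) (metis coeff_power_low[OF a] mult_zero_right not_le)
  also have "\<dots> = (\<Sum>i\<le>?N. \<Sum>j\<le>?N. fps_nth F i * fps_nth G j * coeff (a ^ i * a ^ j) w)"
    by (simp add: sum.cartesian_product power_add)
  also have "\<dots> = (\<Sum>i\<le>?N. \<Sum>j\<le>?N. \<Sum>l\<le>?N.
      fps_nth F i * coeff (a ^ i) (take l w) * (fps_nth G j * coeff (a ^ j) (drop l w)))"
    by (simp add: coeff_times sum_distrib_left mult_ac)
  also have "\<dots> = (\<Sum>i\<le>?N. \<Sum>l\<le>?N. \<Sum>j\<le>?N.
      fps_nth F i * coeff (a ^ i) (take l w) * (fps_nth G j * coeff (a ^ j) (drop l w)))"
    by (intro sum.cong refl sum.swap)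
  also have "\<dots> = (\<Sum>l\<le>?N. \<Sum>i\<le>?N. \<Sum>j\<le>?N.
      fps_nth F i * coeff (a ^ i) (take l w) * (fps_nth G j * coeff (a ^ j) (drop l w)))"
    by (rule sum.swap)
  also have "\<dots> = (\<Sum>l\<le>?N. coeff (fps_eval a F) (take l w) * coeff (fps_eval a G) (drop l w))"
    by (intro sum.cong refl) (simp add: coeff_fps_eval[OF a, where N = ?N] sum_product)
  also have "\<dots> = coeff (fps_eval a F * fps_eval a G) w"
    by (simp add: coeff_times)
  finally show "coeff (fps_eval a (F * G)) w = coeff (fps_eval a F * fps_eval a G) w" .
qed

lemma fps_eval_power: "coeff a [] = 0 \<Longrightarrow> fps_eval a (F ^ n) = fps_eval a F ^ n"
  by (induction n) (simp_all add: fps_eval_mult)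

text \<open>As \<open>F\<close> has no constant term, \<open>F ^ i\<close> starts in degree
  \<open>i\<close>, so the inner sum can run up to \<open>?N\<close> for every \<open>j\<close>. The
  two sums then swap, and \<open>fps_eval_power\<close> identifies the result.\<close>

lemma fps_eval_compose:
  assumes a: "coeff a [] = 0" and F: "fps_nth F 0 = 0"
  shows "fps_eval a (G oo F) = fps_eval (fps_eval a F) G"
proof (rule ncps_eqI)
  fix w :: "letter list"
  let ?N = "length w"
  have "coeff (fps_eval a (G oo F)) w
      = (\<Sum>j\<le>?N. (\<Sum>i\<le>j. fps_nth G i * fps_nth (F ^ i) j) * coeff (a ^ j) w)"
    by (simp add: fps_eval_def fps_compose_nth atMost_atLeast0)
  also have "\<dots> = (\<Sum>j\<le>?N. (\<Sum>i\<le>?N. fps_nth G i * fps_nth (F ^ i) j) * coeff (a ^ j) w)"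
    using startsby_zero_power_prefix[OF F]
    by (intro sum.cong refl arg_cong2[where f = "(*)"] sum.mono_neutral_left) auto
  also have "\<dots> = (\<Sum>i\<le>?N. \<Sum>j\<le>?N. fps_nth G i * (fps_nth (F ^ i) j * coeff (a ^ j) w))"
    by (subst sum.swap) (simp add: sum_distrib_right mult.assoc)
  also have "\<dots> = (\<Sum>i\<le>?N. fps_nth G i * coeff (fps_eval a F ^ i) w)"
    by (simp add: fps_eval_power[OF a, symmetric] coeff_fps_eval[OF a, where N = ?N]
        sum_distrib_left)
  also have "\<dots> = coeff (fps_eval (fps_eval a F) G) w"
    by (simp add: fps_eval_def)
  finally show "coeff (fps_eval a (G oo F)) w = coeff (fps_eval (fps_eval a F) G) w" .
qed

section \<open>Exponential and logarithm\<close>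

lemma nc_exp_eq_fps_eval:
  assumes "coeff a [] = 0"
  shows "nc_exp a = fps_eval a (fps_exp 1)"
proof (rule ncps_eqI)
  fix w :: "letter list"
  have "coeff (nc_exp a) w = (\<Sum>n\<le>length w. coeff (a ^ n) w / fact n)"
    unfolding nc_exp_def coeff_Abs_ncps
    by (rule Sum_any.expand_superset)
       (use coeff_power_low[OF assms] not_le_imp_less in auto)
  then show "coeff (nc_exp a) w = coeff (fps_eval a (fps_exp 1)) w"
    by (simp add: fps_eval_def)
qed

lemma nc_log_eq_fps_eval:
  assumes "coeff f [] = 1"
  shows "nc_log f = fps_eval (f - 1) (fps_ln 1)"
proof (rule ncps_eqI)
  fix w :: "letter list"
  have 0: "coeff (f - 1) [] = 0" using assms by simp
  have low: "coeff ((f - 1) ^ Suc n) w = 0" if "length w \<le> n" for n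
    using that by (intro coeff_power_low[OF 0]) simp
  have "coeff (nc_log f) w
      = (\<Sum>n<length w. (-1) ^ n / of_nat (Suc n) * coeff ((f - 1) ^ Suc n) w)"
    unfolding nc_log_def coeff_Abs_ncps
  proof (rule Sum_any.expand_superset)
    show "{n. (-1) ^ n / of_nat (Suc n) * coeff ((f - 1) ^ Suc n) w \<noteq> 0} \<subseteq> {..<length w}"
      using low by clarify (metis lessThan_iff mult_zero_right not_le)
  qed simp
  also have "\<dots> = (\<Sum>n<length w. fps_nth (fps_ln 1) (Suc n) * coeff ((f - 1) ^ Suc n) w)"
    by (simp add: fps_ln_nth)
  also have "\<dots> = (\<Sum>n\<le>length w. fps_nth (fps_ln 1) n * coeff ((f - 1) ^ n) w)"
    by (subst sum.atMost_shift) simp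
  finally show "coeff (nc_log f) w = coeff (fps_eval (f - 1) (fps_ln 1)) w"
    by (simp add: fps_eval_def)
qed

text \<open>\<open>fps_ln 1\<close> is the compositional inverse of \<open>fps_exp 1 - 1\<close>.
  Together with the next lemma this gives both directions of the correspondence between exp and
  log.\<close>

lemma fps_ln_compose_exp: "fps_ln 1 oo (fps_exp 1 - 1) = (fps_X :: 'a::field_char_0 fps)"
  using fps_inv[of "fps_exp 1 - 1 :: 'a fps"] by (simp add: fps_ln_fps_exp_inv)

lemma fps_exp_compose_ln: "(fps_exp 1 - 1) oo fps_ln 1 = (fps_X :: 'a::field_char_0 fps)"
  using fps_inv_right[of "fps_exp 1 - 1 :: 'a fps"] by (simp add: fps_ln_fps_exp_inv)

lemma nc_log_exp:
  assumes a: "coeff a [] = 0"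
  shows "nc_log (nc_exp a) = a"
proof -
  have "nc_log (nc_exp a) = fps_eval (fps_eval a (fps_exp 1 - 1)) (fps_ln 1)"
    by (simp add: nc_log_eq_fps_eval coeff_nc_exp_Nil a nc_exp_eq_fps_eval fps_eval_diff)
  also have "\<dots> = fps_eval a (fps_ln 1 oo (fps_exp 1 - 1))"
    by (simp add: fps_eval_compose a)
  finally show ?thesis by (simp add: fps_ln_compose_exp fps_eval_X a)
qed

lemma nc_exp_log:
  assumes f: "coeff f [] = 1"
  shows "nc_exp (nc_log f) = f"
proof -
  have 0: "coeff (f - 1) [] = 0" using f by simp
  have "nc_exp (nc_log f) - 1 = fps_eval (nc_log f) (fps_exp 1 - 1)"
    by (simp add: nc_exp_eq_fps_eval coeff_nc_log_Nil f fps_eval_diff)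
  also have "\<dots> = fps_eval (f - 1) ((fps_exp 1 - 1) oo fps_ln 1)"
    by (simp add: nc_log_eq_fps_eval f fps_eval_compose 0)
  finally show ?thesis by (simp add: fps_exp_compose_ln fps_eval_X[OF 0])
qed

text \<open>With the scalar moved into the univariate series, products of exponentials of multiples
  of one \<open>a\<close> fall under \<open>fps_exp_add_mult\<close>.\<close>

lemma nc_exp_scale:
  assumes "coeff a [] = 0"
  shows "nc_exp (nc_scale c a) = fps_eval a (fps_exp c)"
  by (rule ncps_eqI)
     (simp add: nc_exp_eq_fps_eval assms fps_eval_def coeff_power_scale field_simps)

lemma nc_exp_double:
  fixes a :: "'k::field_char_0 ncps"
  assumes "coeff a [] = 0"
  shows "nc_exp (nc_scale 2 a) = nc_exp a * nc_exp a"
  using fps_exp_add_mult[of "1 :: 'k" 1]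
  by (simp add: nc_exp_scale nc_exp_eq_fps_eval[OF assms] assms fps_eval_mult[symmetric])

lemma nc_exp_mult_uminus:
  fixes a :: "'k::field_char_0 ncps"
  assumes "coeff a [] = 0"
  shows "nc_exp a * nc_exp (nc_scale (-1) a) = 1" "nc_exp (nc_scale (-1) a) * nc_exp a = 1"
  using fps_exp_add_mult[of "1 :: 'k" "-1"] fps_exp_add_mult[of "-1 :: 'k" 1]
  by (simp_all add: nc_exp_scale nc_exp_eq_fps_eval[OF assms] assms fps_eval_mult[symmetric])

section \<open>Substitution\<close>

lemma finite_words_length_le: "finite {u :: letter list. length u \<le> N}"
proof -
  have "(UNIV :: letter set) = {LX, LY}" using letter.exhaust by blast
  then have "finite (UNIV :: letter set)" by (metis finite.emptyI finite.insertI)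
  from finite_lists_length_le[OF this, of N] show ?thesis by simp
qed

lemma word_subst_append: "word_subst a b (u @ v) = word_subst a b u * word_subst a b v"
  by (induction a b u rule: word_subst.induct) (simp_all add: mult.assoc)

lemma coeff_nc_compose:
  assumes "coeff a [] = 0" "coeff b [] = 0" "length w \<le> N"
  shows "coeff (nc_compose f a b) w
    = (\<Sum>u | length u \<le> N. coeff f u * coeff (word_subst a b u) w)"
  unfolding nc_compose_def coeff_Abs_ncps
proof (rule Sum_any.expand_superset[OF finite_words_length_le])
  show "{u. coeff f u * coeff (word_subst a b u) w \<noteq> 0} \<subseteq> {u. length u \<le> N}"
    using coeff_word_subst_low[OF assms(1,2), of w] assms(3)
    by clarify (metis le_less_trans mult_zero_right not_le)
qed

lemma coeff_nc_compose_Nil: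
  assumes "coeff a [] = 0" "coeff b [] = 0"
  shows "coeff (nc_compose f a b) [] = coeff f []"
  using coeff_nc_compose[OF assms, of "[]" 0 f] by simp

lemma nc_compose_1: "nc_compose 1 a b = 1"
proof (rule ncps_eqI)
  fix w :: "letter list"
  have "coeff (nc_compose 1 a b) w = (\<Sum>u\<in>{[]}. coeff 1 u * coeff (word_subst a b u) w)"
    unfolding nc_compose_def coeff_Abs_ncps by (rule Sum_any.expand_superset) auto
  then show "coeff (nc_compose 1 a b) w = coeff 1 w" by simp
qed

lemma nc_compose_ncX: "nc_compose ncX a b = a"
proof (rule ncps_eqI)
  fix w :: "letter list"
  have "coeff (nc_compose ncX a b) w = (\<Sum>u\<in>{[LX]}. coeff ncX u * coeff (word_subst a b u) w)"
    unfolding nc_compose_def coeff_Abs_ncps by (rule Sum_any.expand_superset) auto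
  then show "coeff (nc_compose ncX a b) w = coeff a w" by simp
qed

lemma nc_compose_ncY: "nc_compose ncY a b = b"
proof (rule ncps_eqI)
  fix w :: "letter list"
  have "coeff (nc_compose ncY a b) w = (\<Sum>u\<in>{[LY]}. coeff ncY u * coeff (word_subst a b u) w)"
    unfolding nc_compose_def coeff_Abs_ncps by (rule Sum_any.expand_superset) auto
  then show "coeff (nc_compose ncY a b) w = coeff b w" by simp
qed

lemma nc_compose_add:
  assumes "coeff a [] = 0" "coeff b [] = 0"
  shows "nc_compose (f + g) a b = nc_compose f a b + nc_compose g a b"
  by (rule ncps_eqI)
     (simp add: coeff_nc_compose[OF assms order_refl] distrib_right sum.distrib)

lemma nc_compose_diff:
  assumes "coeff a [] = 0" "coeff b [] = 0"
  shows "nc_compose (f - g) a b = nc_compose f a b - nc_compose g a b"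
  by (rule ncps_eqI)
     (simp add: coeff_nc_compose[OF assms order_refl] left_diff_distrib sum_subtractf)

text \<open>A word with a cut position is the same as a pair of words, and \<open>word_subst\<close>
  turns concatenation into multiplication.\<close>

lemma nc_compose_mult:
  fixes a b :: "'k::comm_ring_1 ncps"
  assumes ab: "coeff a [] = 0" "coeff b [] = 0"
  shows "nc_compose (f * g) a b = nc_compose f a b * nc_compose g a b"
proof (rule ncps_eqI)
  fix w :: "letter list"
  let ?N = "length w"
  let ?W = "{u :: letter list. length u \<le> ?N}"
  let ?t = "\<lambda>(p, q). coeff f p * coeff g q * coeff (word_subst a b (p @ q)) w"
  have "coeff (nc_compose (f * g) a b) w = (\<Sum>u\<in>?W. \<Sum>i\<le>length u. ?t (take i u, drop i u))"
    by (simp add: coeff_nc_compose[OF ab order_refl] coeff_times sum_distrib_right)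
  also have "\<dots> = (\<Sum>(u, i)\<in>Sigma ?W (\<lambda>u. {..length u}). ?t (take i u, drop i u))"
    by (rule sum.Sigma) (simp_all add: finite_words_length_le)
  also have "\<dots> = (\<Sum>p\<in>{(p, q). length p + length q \<le> ?N}. ?t p)"
    by (rule sum.reindex_bij_witness[where i = "\<lambda>(p, q). (p @ q, length p)"
          and j = "\<lambda>(u, i). (take i u, drop i u)"]) auto
  \<comment> \<open>Pairs of total length above \<open>?N\<close> may be added: substituting into
    their concatenation leaves nothing on \<open>w\<close>.\<close>
  also have "\<dots> = (\<Sum>p\<in>?W \<times> ?W. ?t p)"
    by (rule sum.mono_neutral_left, auto simp: finite_words_length_le)
       (metis coeff_word_subst_low[OF ab] length_append mult_zero_right not_le)
  also have "\<dots> = (\<Sum>p\<in>?W. \<Sum>q\<in>?W.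
      coeff f p * coeff g q * coeff (word_subst a b p * word_subst a b q) w)"
    by (simp add: sum.cartesian_product word_subst_append)
  also have "\<dots> = (\<Sum>p\<in>?W. \<Sum>q\<in>?W. \<Sum>l\<le>?N.
      coeff f p * coeff (word_subst a b p) (take l w)
      * (coeff g q * coeff (word_subst a b q) (drop l w)))"
    by (simp add: coeff_times sum_distrib_left mult_ac)
  also have "\<dots> = (\<Sum>p\<in>?W. \<Sum>l\<le>?N. \<Sum>q\<in>?W.
      coeff f p * coeff (word_subst a b p) (take l w)
      * (coeff g q * coeff (word_subst a b q) (drop l w)))"
    by (intro sum.cong refl sum.swap)
  also have "\<dots> = (\<Sum>l\<le>?N. \<Sum>p\<in>?W. \<Sum>q\<in>?W.
      coeff f p * coeff (word_subst a b p) (take l w)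
      * (coeff g q * coeff (word_subst a b q) (drop l w)))"
    by (rule sum.swap)
  also have "\<dots> = (\<Sum>l\<le>?N. coeff (nc_compose f a b) (take l w) * coeff (nc_compose g a b) (drop l w))"
    by (intro sum.cong refl) (simp add: coeff_nc_compose[OF ab, where N = ?N] sum_product)
  also have "\<dots> = coeff (nc_compose f a b * nc_compose g a b) w"
    by (simp add: coeff_times)
  finally show "coeff (nc_compose (f * g) a b) w = coeff (nc_compose f a b * nc_compose g a b) w" .
qed

lemma nc_compose_power:
  fixes a b :: "'k::comm_ring_1 ncps"
  assumes "coeff a [] = 0" "coeff b [] = 0"
  shows "nc_compose (f ^ n) a b = nc_compose f a b ^ n"
  by (induction n) (simp_all add: nc_compose_1 nc_compose_mult assms)

text \<open>Substitution respects powers, and only finitely many powers and words reach a given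
  \<open>w\<close>, so the sums swap. Compatibility with exp and log follows.\<close>

lemma nc_compose_fps_eval:
  assumes ab: "coeff a [] = 0" "coeff b [] = 0" and c: "coeff c [] = 0"
  shows "nc_compose (fps_eval c F) a b = fps_eval (nc_compose c a b) F"
proof (rule ncps_eqI)
  fix w :: "letter list"
  let ?N = "length w"
  let ?W = "{u :: letter list. length u \<le> ?N}"
  have "coeff (nc_compose (fps_eval c F) a b) w
      = (\<Sum>u\<in>?W. \<Sum>i\<le>?N. fps_nth F i * (coeff (c ^ i) u * coeff (word_subst a b u) w))"
    by (simp add: coeff_nc_compose[OF ab order_refl] coeff_fps_eval[OF c, where N = ?N]
        sum_distrib_right mult.assoc)
  also have "\<dots> = (\<Sum>i\<le>?N. \<Sum>u\<in>?W. fps_nth F i * (coeff (c ^ i) u * coeff (word_subst a b u) w))"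
    by (rule sum.swap)
  also have "\<dots> = coeff (fps_eval (nc_compose c a b) F) w"
    by (simp add: fps_eval_def nc_compose_power[OF ab, symmetric]
        coeff_nc_compose[OF ab order_refl] sum_distrib_left)
  finally show "coeff (nc_compose (fps_eval c F) a b) w
      = coeff (fps_eval (nc_compose c a b) F) w" .
qed

lemma nc_compose_exp:
  assumes "coeff a [] = 0" "coeff b [] = 0" "coeff c [] = 0"
  shows "nc_compose (nc_exp c) a b = nc_exp (nc_compose c a b)"
  by (simp add: nc_exp_eq_fps_eval assms coeff_nc_compose_Nil nc_compose_fps_eval)

lemma nc_compose_log:
  assumes "coeff a [] = 0" "coeff b [] = 0" "coeff f [] = 1"
  shows "nc_compose (nc_log f) a b = nc_log (nc_compose f a b)"
  by (simp add: nc_log_eq_fps_eval assms coeff_nc_compose_Nil nc_compose_fps_eval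
      nc_compose_diff nc_compose_1)

text \<open>Reconciles the two readings of the bracket of \<open>a\<close> and \<open>b\<close>: log
  of a product of exponentials, and composite of the universal series.\<close>

lemma nc_compose_bch:
  assumes "coeff a [] = 0" "coeff b [] = 0"
  shows "nc_compose (bch ncX ncY) a b = bch a b"
  by (simp add: bch_def nc_compose_log nc_compose_mult nc_compose_exp assms
      coeff_times coeff_nc_exp_Nil nc_compose_ncX nc_compose_ncY)

section \<open>Scaling and lowest-degree terms of substituted words\<close>

lemma coeff_word_subst_scale:
  fixes c :: "'k::comm_ring_1"
  shows "coeff (word_subst (nc_scale c a) (nc_scale c b) u) w
    = c ^ length u * coeff (word_subst a b u) w"
proof (induction a b u arbitrary: w rule: word_subst.induct)
  case (2 a b u)
  then show ?case by (simp add: coeff_times sum_distrib_left mult_ac)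
next
  case (3 a b u)
  then show ?case by (simp add: coeff_times sum_distrib_left mult_ac)
qed simp

text \<open>Only the cut after the first letter survives: the empty prefix meets the zero constant
  term of \<open>a\<close>, and a longer prefix leaves \<open>g\<close> a word that is too
  short.\<close>

lemma coeff_times_lead:
  assumes a: "coeff a [] = 0" and g: "\<And>v. length v < length w \<Longrightarrow> coeff g v = 0"
  shows "coeff (a * g) (x # w) = coeff a [x] * coeff g w"
proof -
  have "coeff (a * g) (x # w)
      = (\<Sum>i\<in>{1}. coeff a (take i (x # w)) * coeff g (drop i (x # w)))"
    unfolding coeff_times
  proof (rule sum.mono_neutral_right)
    show "\<forall>i\<in>{..length (x # w)} - {1}. coeff a (take i (x # w)) * coeff g (drop i (x # w)) = 0"
    proof
      fix i assume i: "i \<in> {..length (x # w)} - {1}"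
      show "coeff a (take i (x # w)) * coeff g (drop i (x # w)) = 0"
      proof (cases "i = 0")
        case False
        then have "length (drop i (x # w)) < length w" using i by auto
        then show ?thesis using g by simp
      qed (simp add: a)
    qed
  qed auto
  then show ?thesis by simp
qed

text \<open>On words as long as \<open>u\<close>, each substituted factor supplies exactly one
  letter, so only linear parts matter.\<close>

lemma coeff_word_subst_lead_cong:
  assumes "coeff a [] = 0" "coeff b [] = 0" "coeff a' [] = 0" "coeff b' [] = 0"
    and "\<And>x. coeff a [x] = coeff a' [x]" "\<And>x. coeff b [x] = coeff b' [x]"
    and "length w = length u"
  shows "coeff (word_subst a b u) w = coeff (word_subst a' b' u) w"
  using assms(7)
proof (induction u arbitrary: w)
  case (Cons y u)
  then obtain x v where "w = x # v" "length v = length u" by (cases w) auto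
  with Cons.IH assms(1-6) show ?case
    by (cases y) (simp_all add: coeff_times_lead coeff_word_subst_low)
qed simp

section \<open>The Baker-Campbell-Hausdorff series\<close>

lemma nc_exp_bch:
  assumes "coeff a [] = 0" "coeff b [] = 0"
  shows "nc_exp (bch a b) = nc_exp a * nc_exp b"
  unfolding bch_def by (rule nc_exp_log) (simp add: coeff_times coeff_nc_exp_Nil assms)

lemma bch_assoc:
  assumes "coeff a [] = 0" "coeff b [] = 0" "coeff c [] = 0"
  shows "bch (bch a b) c = bch a (bch b c)"
  by (simp add: bch_def[of "bch a b"] bch_def[of a "bch b c"] nc_exp_bch assms mult.assoc)

lemma bch_self: "coeff a [] = 0 \<Longrightarrow> bch a a = nc_scale 2 a"
  by (simp add: bch_def nc_exp_double[symmetric] nc_log_exp)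

text \<open>The product of the exponentials of \<open>-a\<close> and \<open>-b\<close> is the
  inverse of \<open>nc_exp b * nc_exp a\<close>; taking logarithms turns the inverse into a
  sign.\<close>

lemma bch_commute_uminus:
  assumes ab: "coeff a [] = 0" "coeff b [] = 0"
  shows "bch b a = nc_scale (-1) (bch (nc_scale (-1) a) (nc_scale (-1) b))"
proof -
  define c where "c = bch (nc_scale (-1) a) (nc_scale (-1) b)"
  have c: "coeff c [] = 0" unfolding c_def by (intro coeff_bch_Nil) (simp_all add: ab)
  have "nc_exp b * nc_exp a * nc_exp c
      = nc_exp b * (nc_exp a * nc_exp (nc_scale (-1) a)) * nc_exp (nc_scale (-1) b)"
    unfolding c_def by (subst nc_exp_bch) (simp_all add: ab mult.assoc)
  also have "\<dots> = 1" by (simp add: nc_exp_mult_uminus ab)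
  finally have "nc_exp b * nc_exp a * nc_exp c = 1" .
  then have "nc_exp b * nc_exp a = nc_exp (nc_scale (-1) c)"
    by (metis c mult.assoc mult_1_left mult_1_right nc_exp_mult_uminus(1))
  then show ?thesis
    unfolding c_def[symmetric] by (simp add: bch_def nc_log_exp c)
qed

lemma coeff_bch_scale:
  "coeff (bch (nc_scale c ncX) (nc_scale c ncY)) w = c ^ length w * coeff (bch ncX ncY) w"
proof -
  let ?W = "{u :: letter list. length u \<le> length w}"
  \<comment> \<open>Substituting the variables for themselves returns the monomial \<open>u\<close>,
    so after scaling only \<open>u = w\<close> contributes, with factor
    \<open>c ^ length w\<close>.\<close>
  have XY: "coeff (word_subst ncX ncY u) w = (if u = w then 1 else (0::'a))" for u w
  proof (induction u arbitrary: w)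
    case (Cons x u)
    show ?case
    proof (cases w)
      case (Cons y v)
      have "coeff (word_subst ncX ncY (x # u)) (y # v)
          = (\<Sum>i\<in>{1}. coeff (word_subst ncX ncY [x]) (take i (y # v))
              * coeff (word_subst ncX ncY u) (drop i (y # v)) :: 'a)"
        unfolding word_subst_append[of _ _ "[x]" u, simplified append.simps] coeff_times
      proof (rule sum.mono_neutral_right)
        show "\<forall>i\<in>{..length (y # v)} - {1}. coeff (word_subst ncX ncY [x]) (take i (y # v))
              * coeff (word_subst ncX ncY u) (drop i (y # v)) = (0::'a)"
          by (cases x) (auto simp: take_Cons split: nat.splits)
      qed auto
      then show ?thesis using Cons Cons.IH by (cases x; cases y) simp_all
    qed (cases x; simp add: coeff_times)
  qed auto
  have "coeff (bch (nc_scale c ncX) (nc_scale c ncY)) w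
      = (\<Sum>u\<in>?W. coeff (bch ncX ncY) u * (c ^ length u * (if u = w then 1 else 0)))"
    by (subst nc_compose_bch[symmetric]) (simp_all add: coeff_nc_compose[OF _ _ order_refl]
        coeff_word_subst_scale XY)
  also have "\<dots> = (\<Sum>u\<in>{w}. coeff (bch ncX ncY) u * (c ^ length u * (if u = w then 1 else 0)))"
    by (rule sum.mono_neutral_right) (auto simp: finite_words_length_le)
  finally show ?thesis by (simp add: mult.commute)
qed

lemma coeff_bch_singleton:
  assumes "coeff a [] = 0" "coeff b [] = 0"
  shows "coeff (bch a b) [x] = coeff a [x] + coeff b [x]"
proof -
  have e: "coeff (nc_exp a * nc_exp b) [] = 1"
    by (simp add: coeff_times coeff_nc_exp_Nil assms)
  then show ?thesis
    by (simp add: bch_def nc_log_eq_fps_eval coeff_fps_eval_singleton fps_ln_nth coeff_times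
        nc_exp_eq_fps_eval assms add.commute)
qed

section \<open>Expansion by degree before substitution\<close>

lemma coeff_bch_term:
  assumes "coeff a [] = 0" "coeff b [] = 0" "length w \<le> N"
  shows "coeff (bch_term m a b) w = (\<Sum>u | length u \<le> N.
    if length u = m then coeff (bch ncX ncY) u * coeff (word_subst a b u) w else 0)"
  unfolding bch_term_def by (subst coeff_nc_compose[OF assms]) (auto intro!: sum.cong)

lemma bch_term_0: "bch_term 0 a b = 0"
  for a b :: "'k::field_char_0 ncps"
proof -
  have "coeff (hom_part 0 (bch ncX ncY)) w = (0 :: 'k)" for w
    using coeff_bch_Nil[of "ncX :: 'k ncps" ncY] by simp
  then show ?thesis
    unfolding bch_term_def nc_compose_def by (intro ncps_eqI) simp
qed

lemma bch_term_1:
  fixes a b :: "'k::field_char_0 ncps"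
  assumes "coeff a [] = 0" "coeff b [] = 0"
  shows "bch_term 1 a b = a + b"
proof -
  have "hom_part 1 (bch ncX ncY) = (ncX + ncY :: 'k ncps)"
    by (rule ncps_eqI) (auto simp: length_Suc_conv coeff_bch_singleton intro: letter.exhaust)
  then show ?thesis
    unfolding bch_term_def by (simp only: nc_compose_add assms nc_compose_ncX nc_compose_ncY)
qed

text \<open>The words \<open>u\<close> are grouped by length \<open>m\<close>. Those longer than
  \<open>w\<close> do not reach it, \<open>m = 0\<close> gives zero, \<open>m = 1\<close> gives
  \<open>a + b\<close>, and \<open>m = length w\<close> is kept apart from
  \<open>bch_lt\<close>.\<close>

lemma coeff_bch_expand:
  assumes ab: "coeff a [] = 0" "coeff b [] = 0" and n: "1 < length w"
  shows "coeff (bch a b) w = coeff a w + coeff b w + coeff (bch_lt (length w) a b) w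
    + coeff (bch_term (length w) a b) w"
proof -
  let ?n = "length w"
  let ?W = "{u :: letter list. length u \<le> ?n}"
  have "coeff (bch a b) w = (\<Sum>u\<in>?W. coeff (bch ncX ncY) u * coeff (word_subst a b u) w)"
    by (subst nc_compose_bch[OF ab, symmetric]) (simp add: coeff_nc_compose[OF ab order_refl])
  also have "\<dots> = (\<Sum>u\<in>?W. \<Sum>m\<le>?n.
      if length u = m then coeff (bch ncX ncY) u * coeff (word_subst a b u) w else 0)"
    by (intro sum.cong refl) simp
  also have "\<dots> = (\<Sum>m\<le>?n. coeff (bch_term m a b) w)"
    by (subst sum.swap) (simp add: coeff_bch_term[OF ab order_refl])
  also have "{..?n} = {0, 1} \<union> {1<..<?n} \<union> {?n}"
    using n by auto
  also have "(\<Sum>m\<in>\<dots>. coeff (bch_term m a b) w) = coeff (bch_term 0 a b) w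
      + coeff (bch_term 1 a b) w + coeff (bch_lt ?n a b) w + coeff (bch_term ?n a b) w"
    using n by (subst sum.union_disjoint, simp, simp, force)
      (subst sum.union_disjoint, auto simp: bch_lt_def)
  finally show ?thesis by (simp add: bch_term_0 bch_term_1[OF ab, simplified])
qed

lemma coeff_bch_term_lead_cong:
  assumes "coeff a [] = 0" "coeff b [] = 0" "coeff a' [] = 0" "coeff b' [] = 0"
    and "\<And>x. coeff a [x] = coeff a' [x]" "\<And>x. coeff b [x] = coeff b' [x]"
  shows "coeff (bch_term (length w) a b) w = coeff (bch_term (length w) a' b') w"
  using coeff_word_subst_lead_cong[OF assms]
  by (simp add: coeff_bch_term[OF _ _ order_refl] assms(1-4) cong: if_cong)

text \<open>Under exp, the left side is the product of two factors \<open>nc_exp a\<close> followed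
  by two factors \<open>nc_exp b\<close>.\<close>

lemma bch_nested_double:
  assumes "coeff a [] = 0" "coeff b [] = 0"
  shows "bch a (bch (bch a b) b) = bch (nc_scale 2 a) (nc_scale 2 b)"
  by (simp add: bch_assoc coeff_bch_Nil assms bch_self[symmetric])

text \<open>Under exp, the left side is the square of \<open>nc_exp a * nc_exp b\<close>.\<close>

lemma bch_nested_alternating:
  assumes "coeff a [] = 0" "coeff b [] = 0"
  shows "bch a (bch (bch b a) b) = nc_scale 2 (bch a b)"
  by (simp add: bch_assoc coeff_bch_Nil assms bch_self[symmetric])

theorem mainTheorem1:
  fixes n :: nat
  assumes "n > 2"
  defines "X \<equiv> (ncX :: 'k::field_char_0 ncps)" and "Y \<equiv> (ncY :: 'k ncps)"
  shows "nc_scale (2 ^ n - (-1) ^ n - 3) (hom_part n (bch X Y)) =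
      hom_part n (bch_lt n (bch X Y) Y)
    - hom_part n (bch_lt n (bch Y X) Y)
    + hom_part n (bch_lt n X (bch (bch X Y) Y))
    - hom_part n (bch_lt n X (bch (bch Y X) Y))"
proof (rule ncps_eqI)
  fix w :: "letter list"
  let ?c = "\<lambda>f. coeff f w"
  have [simp]: "coeff X [] = 0" "coeff Y [] = 0" by (simp_all add: X_def Y_def)
  note [simp] = coeff_bch_Nil
  show "?c (nc_scale (2 ^ n - (-1) ^ n - 3) (hom_part n (bch X Y))) =
      ?c (hom_part n (bch_lt n (bch X Y) Y)
    - hom_part n (bch_lt n (bch Y X) Y)
    + hom_part n (bch_lt n X (bch (bch X Y) Y))
    - hom_part n (bch_lt n X (bch (bch Y X) Y)))"
  proof (cases "length w = n")
    case True
    note expand = coeff_bch_expand[of _ _ w, unfolded True]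
    note lead = coeff_bch_term_lead_cong[where w = w, unfolded True]
    \<comment> \<open>The inner brackets \<open>bch X Y\<close> and \<open>bch Y X\<close> share the
      linear part \<open>X + Y\<close>.\<close>
    have lead1: "?c (bch_term n (bch X Y) Y) = ?c (bch_term n (bch Y X) Y)"
      by (rule lead) (simp_all add: coeff_bch_singleton)
    have lead2: "?c (bch_term n X (bch (bch X Y) Y)) = ?c (bch_term n X (bch (bch Y X) Y))"
      by (rule lead) (simp_all add: coeff_bch_singleton)
    have YX: "?c (bch Y X) = - ((-1) ^ n * ?c (bch X Y))"
      using True by (simp add: bch_commute_uminus[of X Y]) (simp add: X_def Y_def coeff_bch_scale)
    \<comment> \<open>Doubling both variables multiplies the coefficient on a word of length
      \<open>n\<close> by \<open>2 ^ n\<close>.\<close>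
    have "2 ^ n * ?c (bch X Y) = ?c (bch X (bch (bch X Y) Y))"
      using True by (simp add: bch_nested_double) (simp add: X_def Y_def coeff_bch_scale)
    \<comment> \<open>The outer bracket is expanded first; its second argument contributes the
      expansion of \<open>bch (bch X Y) Y\<close> in parentheses.\<close>
    also have "\<dots> = ?c X + (?c (bch X Y) + ?c Y + ?c (bch_lt n (bch X Y) Y)
        + ?c (bch_term n (bch X Y) Y)) + ?c (bch_lt n X (bch (bch X Y) Y))
        + ?c (bch_term n X (bch (bch X Y) Y))"
      using assms(1) by (simp add: expand[of X] expand[of "bch X Y"])
    finally have 1: "2 ^ n * ?c (bch X Y) = \<dots>" .
    have "2 * ?c (bch X Y) = ?c (bch X (bch (bch Y X) Y))"
      by (simp add: bch_nested_alternating)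
    also have "\<dots> = ?c X + (?c (bch Y X) + ?c Y + ?c (bch_lt n (bch Y X) Y)
        + ?c (bch_term n (bch Y X) Y)) + ?c (bch_lt n X (bch (bch Y X) Y))
        + ?c (bch_term n X (bch (bch Y X) Y))"
      using assms(1) by (simp add: expand[of X] expand[of "bch Y X"])
    finally have 2: "2 * ?c (bch X Y) = \<dots>" .
    \<comment> \<open>In \<open>1\<close> minus \<open>2\<close> the leading terms cancel. By
      \<open>YX\<close>, \<open>?c (bch X Y) - ?c (bch Y X)\<close> is
      \<open>(1 + (-1) ^ n) * ?c (bch X Y)\<close>; moved to the left, it turns the factor
      \<open>2 ^ n - 2\<close> into \<open>2 ^ n - (-1) ^ n - 3\<close>.\<close>
    show ?thesis
      using 1 2 lead1 lead2 YX True by (simp add: algebra_simps)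
  qed simp
qed

end
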